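(* At least one of the following two assertions is false: (A) For all integers $k\ge 1$ and $p \geq 3$, $$ gr_{k}(K_{3} : K_{p}) = \begin{cases} (r(p) - 1)^{k/2} + 1 & \text{if $k$ is even,}\\ (p - 1)(r(p) - 1)^{(k - 1)/2} + 1 & \text{if $k$ is odd,} \end{cases} $$ where $r(p)$ denotes the two-color Ramsey number of $K_p$. (B) The two-color Ramsey number of $K_5$ equals $43$, i.e. $r(5) = 43$.
   Context: A $k$-coloring of the edges of a complete graph assigns to each edge one of $k$ colors (not all colors need be used; it is not required to be a proper coloring). A rainbow triangle is a triangle whose three edges have three distinct colors. For a graph $H$ and a positive integer $k$, the $k$-colored Gallai-Ramsey number $gr_k(K_3 : H)$ is the minimum integer $n$ such that for every $N \ge n$, every $k$-coloring of the edges of $K_N$ contains either a rainbow triangle or a monochromatic copy of $H$. The number $r(p) = R(K_p,K_p)$ is the least $n$ such that every $2$-coloring of the edges of $K_n$ contains a monochromatic $K_p$. *)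

theory Defs
  imports "HOL-Library.Ramsey"
begin

text \<open>
  A simple graph is a pair of its vertex set and its edge set, edges being 2-element vertex sets;
  \<open>nsets A 2\<close> is the set of all 2-element subsets of \<open>A\<close>.
\<close>

type_synonym 'a sgraph = "'a set \<times> 'a set set"

definition complete_graph :: "nat \<Rightarrow> nat sgraph" where
  "complete_graph n = ({..<n}, nsets {..<n} 2)"

definition edge_coloring :: "nat \<Rightarrow> 'a sgraph \<Rightarrow> ('a set \<Rightarrow> nat) \<Rightarrow> bool" where
  "edge_coloring k G c \<longleftrightarrow> c \<in> snd G \<rightarrow> {..<k}"

definition has_rainbow_triangle :: "'a sgraph \<Rightarrow> ('a set \<Rightarrow> nat) \<Rightarrow> bool" where
  "has_rainbow_triangle G c \<longleftrightarrow>
     (\<exists>x y z. {x, y} \<in> snd G \<and> {y, z} \<in> snd G \<and> {x, z} \<in> snd G \<and>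
        c {x, y} \<noteq> c {y, z} \<and> c {y, z} \<noteq> c {x, z} \<and> c {x, y} \<noteq> c {x, z})"

text \<open>A copy of \<open>H\<close> in \<open>G\<close> is a subgraph of \<open>G\<close>, not necessarily induced, isomorphic to \<open>H\<close>.\<close>

definition has_mono_copy :: "'b sgraph \<Rightarrow> 'a sgraph \<Rightarrow> ('a set \<Rightarrow> nat) \<Rightarrow> bool" where
  "has_mono_copy H G c \<longleftrightarrow>
     (\<exists>f i. inj_on f (fst H) \<and> f ` fst H \<subseteq> fst G \<and>
        (\<forall>e \<in> snd H. f ` e \<in> snd G \<and> c (f ` e) = i))"

text \<open>
  By Ramsey's theorem the sets of which the least element is taken below are nonempty
  (for finite \<open>H\<close>), so \<open>LEAST\<close> denotes a genuine minimum.
\<close>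

definition gallai_ramsey :: "nat \<Rightarrow> 'b sgraph \<Rightarrow> nat" where
  "gallai_ramsey k H =
     (LEAST n. \<forall>N \<ge> n. \<forall>c. edge_coloring k (complete_graph N) c \<longrightarrow>
        has_rainbow_triangle (complete_graph N) c \<or> has_mono_copy H (complete_graph N) c)"

definition ramsey_number :: "nat \<Rightarrow> nat" where
  "ramsey_number p =
     (LEAST n. \<forall>c. edge_coloring 2 (complete_graph n) c \<longrightarrow>
        has_mono_copy (complete_graph p) (complete_graph n) c)"

lemma ramsey_number_partn:
  "ramsey_number p = (LEAST n. partn {..<n} p 2 {..<2::nat})" if "p \<ge> 2"
proof -
  have "(\<forall>c. edge_coloring 2 (complete_graph n) c \<longrightarrow>
            has_mono_copy (complete_graph p) (complete_graph n) c)
        \<longleftrightarrow> partn {..<n} p 2 {..<2::nat}" for n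
  proof -
    have "has_mono_copy (complete_graph p) (complete_graph n) c
          \<longleftrightarrow> (\<exists>i\<in>{..<2}. monochromatic {..<n} p 2 c i)"
      if c: "c \<in> nsets {..<n} 2 \<rightarrow> {..<2::nat}" for c :: "nat set \<Rightarrow> nat"
    proof
      assume "has_mono_copy (complete_graph p) (complete_graph n) c"
      then obtain f i where f: "inj_on f {..<p}" "f ` {..<p} \<subseteq> {..<n}"
        and i: "\<And>e. e \<in> nsets {..<p} 2 \<Longrightarrow> f ` e \<in> nsets {..<n} 2 \<and> c (f ` e) = i"
        by (auto simp: has_mono_copy_def complete_graph_def)
      have "f ` {..<p} \<in> nsets {..<n} p"
        using f by (auto simp: nsets_def card_image)
      moreover have "c ` nsets (f ` {..<p}) 2 \<subseteq> {i}"
        using i f(1) by (auto elim!: nset_image_obtains)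
      moreover have "i < 2"
      proof -
        have "{0, 1} \<in> nsets {..<p} 2" using \<open>p \<ge> 2\<close> by auto
        then show ?thesis using i c by fastforce
      qed
      ultimately show "\<exists>i\<in>{..<2}. monochromatic {..<n} p 2 c i"
        by (auto simp: monochromatic_def)
    next
      assume "\<exists>i\<in>{..<2}. monochromatic {..<n} p 2 c i"
      then obtain i S where S: "S \<in> nsets {..<n} p" and i: "c ` nsets S 2 \<subseteq> {i}"
        by (auto simp: monochromatic_def)
      then obtain f where f: "bij_betw f {..<p} S"
        using ex_bij_betw_nat_finite[of S] by (auto simp: nsets_def atLeast0LessThan)
      have "f ` e \<in> nsets S 2" if "e \<in> nsets {..<p} 2" for e
        using bij_betw_nsets[OF f, of 2] that by (auto simp: bij_betw_def)
      moreover have "nsets S 2 \<subseteq> nsets {..<n} 2"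
        using S by (intro nsets_mono) (auto simp: nsets_def)
      moreover have "f ` {..<p} \<subseteq> {..<n}" "inj_on f {..<p}"
        using f S by (auto simp: bij_betw_def nsets_def)
      ultimately show "has_mono_copy (complete_graph p) (complete_graph n) c"
        using i unfolding has_mono_copy_def complete_graph_def fst_conv snd_conv
        by (intro exI[of _ f] exI[of _ i]) blast
    qed
    then show ?thesis
      unfolding edge_coloring_def partn_def complete_graph_def snd_conv by blast
  qed
  then show ?thesis by (simp add: ramsey_number_def)
qed

end

theory Submission
  imports Defs
begin

text \<open>
  If \<open>r(5) = 43\<close>, the formula predicts \<open>4 * 42 + 1 = 169\<close> for \<open>k = 3\<close> and \<open>p = 5\<close>, so it suffices to
  colour \<open>K\<^sub>1\<^sub>6\<^sub>9\<close> with three colours without a rainbow triangle and without a monochromatic \<open>K\<^sub>5\<close>.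
  The prediction corresponds to splitting the colours into one pair, used on an optimal
  \<open>(5,5)\<close>-Ramsey colouring of \<open>K\<^sub>4\<^sub>2\<close>, and one singleton. But a colour can also be shared by two
  factors, since clique numbers multiply under lexicographic products and \<open>4 = 2 * 2\<close>.
  The extremal colouring for \<open>R(3,5) = 14\<close> lives on \<open>13\<close> vertices and has monochromatic cliques of
  size at most \<open>2\<close> in one colour and at most \<open>4\<close> in the other. The product of two copies that share
  the first colour and use separate second colours has clique numbers \<open>2 * 2\<close>, \<open>4 * 1\<close>, \<open>1 * 4\<close>,
  and \<open>13 * 13 = 169\<close> vertices: one more than \<open>4 * 42 = 168\<close>.

  The product colouring has no rainbow triangle because neither factor has one
  (\<open>no_rainbow_lex\<close>), its clique numbers are bounded by \<open>card_mono_lex\<close>, and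
  \<open>gallai_ramsey_greater\<close> turns it into a strict lower bound for the Gallai-Ramsey number. The
  last step invokes Ramsey's theorem, without which the least element defining that number would be
  unspecified.
\<close>

section \<open>Lower bounds from colourings\<close>

text \<open>
  Colourings are handled here as symmetric binary functions on an arbitrary vertex type, so that
  products of vertex sets can be used directly.
\<close>

definition no_rainbow :: "'a set \<Rightarrow> ('a \<Rightarrow> 'a \<Rightarrow> nat) \<Rightarrow> bool" where
  "no_rainbow V c \<longleftrightarrow> (\<forall>x\<in>V. \<forall>y\<in>V. \<forall>z\<in>V. x \<noteq> y \<longrightarrow> y \<noteq> z \<longrightarrow> x \<noteq> z \<longrightarrow>
     c x y = c y z \<or> c y z = c x z \<or> c x y = c x z)"

lemma has_mono_copy_complete_graphI:
  assumes S: "S \<in> nsets {..<N} p" and mono: "c ` nsets S 2 \<subseteq> {i}"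
  shows "has_mono_copy (complete_graph p) (complete_graph N) c"
proof -
  obtain f where f: "bij_betw f {..<p} S"
    using S ex_bij_betw_nat_finite[of S] by (auto simp: nsets_def atLeast0LessThan)
  have "f ` e \<in> nsets S 2" if "e \<in> nsets {..<p} 2" for e
    using bij_betw_nsets[OF f, of 2] that by (auto simp: bij_betw_def)
  moreover have "nsets S 2 \<subseteq> nsets {..<N} 2"
    using S by (intro nsets_mono) (auto simp: nsets_def)
  moreover have "f ` {..<p} \<subseteq> {..<N}" "inj_on f {..<p}"
    using f S by (auto simp: bij_betw_def nsets_def)
  ultimately show ?thesis
    using mono unfolding has_mono_copy_def complete_graph_def fst_conv snd_conv
    by (intro exI[of _ f] exI[of _ i]) blast
qed

text \<open>
  Ramsey's theorem for \<open>k\<close> colours gives a bound for the colourings of one complete graph; it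
  persists for larger ones because partition relations are monotone in the underlying set.
\<close>

lemma gallai_ramsey_witness:
  "\<exists>n. \<forall>N\<ge>n. \<forall>c. edge_coloring k (complete_graph N) c \<longrightarrow>
     has_rainbow_triangle (complete_graph N) c \<or> has_mono_copy (complete_graph p) (complete_graph N) c"
proof -
  obtain n :: nat where n: "partn_lst {..<n} (replicate k p) 2"
    using ramsey_full[of "replicate k p" 2] by blast
  have "has_mono_copy (complete_graph p) (complete_graph N) c"
    if "N \<ge> n" and c: "edge_coloring k (complete_graph N) c" for N c
  proof -
    have "partn_lst {..<N} (replicate k p) 2"
      using partn_lst_greater_resource[OF n] \<open>N \<ge> n\<close> by auto
    moreover have "c \<in> nsets {..<N} 2 \<rightarrow> {..<length (replicate k p)}"
      using c by (simp add: edge_coloring_def complete_graph_def)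
    ultimately obtain i S where "i < k" "S \<in> nsets {..<N} p" "c ` nsets S 2 \<subseteq> {i}"
      by (auto simp: partn_lst_def monochromatic_def)
    then show ?thesis
      by (intro has_mono_copy_complete_graphI)
  qed
  then show ?thesis by blast
qed

lemma gallai_ramsey_greater:
  fixes c :: "'a \<Rightarrow> 'a \<Rightarrow> nat"
  assumes "finite V"
    and sym: "\<And>x y. c x y = c y x"
    and colours: "\<And>x y. x \<in> V \<Longrightarrow> y \<in> V \<Longrightarrow> c x y < k"
    and rainbow: "no_rainbow V c"
    and mono: "\<And>i S. S \<subseteq> V \<Longrightarrow> pairwise (\<lambda>x y. c x y = i) S \<Longrightarrow> card S < p"
  shows "card V < gallai_ramsey k (complete_graph p)"
proof (rule ccontr)
  let ?N = "card V"
  assume "\<not> ?N < gallai_ramsey k (complete_graph p)"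
  then have "gallai_ramsey k (complete_graph p) \<le> ?N"
    by simp
  then have forced: "has_rainbow_triangle (complete_graph ?N) d \<or>
      has_mono_copy (complete_graph p) (complete_graph ?N) d"
    if "edge_coloring k (complete_graph ?N) d" for d
    using LeastI_ex[OF gallai_ramsey_witness[of k p], folded gallai_ramsey_def] that by blast
  obtain h where h: "bij_betw h {..<?N} V"
    using ex_bij_betw_nat_finite[OF \<open>finite V\<close>] by (auto simp: atLeast0LessThan)
  have hV: "h x \<in> V" if "x < ?N" for x
    using h that by (auto simp: bij_betw_def)
  have h_inj: "h x = h y \<longleftrightarrow> x = y" if "x < ?N" "y < ?N" for x y
    using h that by (auto simp: bij_betw_def inj_on_def)
  define d where "d e = c (h (Min e)) (h (Max e))" for e
  have d: "d {x, y} = c (h x) (h y)" for x y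
    by (cases x y rule: linorder_cases) (auto simp: d_def sym)
  have edge: "{x, y} \<in> nsets {..<?N} 2 \<longleftrightarrow> x < ?N \<and> y < ?N \<and> x \<noteq> y" for x y
    by (auto simp: nsets_2_eq doubleton_eq_iff)
  have "edge_coloring k (complete_graph ?N) d"
    using colours hV by (auto simp: edge_coloring_def complete_graph_def nsets_2_eq d)
  then consider "has_rainbow_triangle (complete_graph ?N) d"
    | "has_mono_copy (complete_graph p) (complete_graph ?N) d"
    using forced by blast
  then show False
  proof cases
    case 1
    then obtain x y z where "x < ?N" "y < ?N" "z < ?N" "x \<noteq> y" "y \<noteq> z" "x \<noteq> z"
      and "c (h x) (h y) \<noteq> c (h y) (h z)" "c (h y) (h z) \<noteq> c (h x) (h z)"
        "c (h x) (h y) \<noteq> c (h x) (h z)"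
      by (auto simp: has_rainbow_triangle_def complete_graph_def edge d)
    then show False
      using rainbow hV h_inj unfolding no_rainbow_def by blast
  next
    case 2
    then obtain f i where f: "inj_on f {..<p}" "f ` {..<p} \<subseteq> {..<?N}"
      and i: "\<And>e. e \<in> nsets {..<p} 2 \<Longrightarrow> d (f ` e) = i"
      by (auto simp: has_mono_copy_def complete_graph_def)
    let ?S = "(h \<circ> f) ` {..<p}"
    have "c (h (f x)) (h (f y)) = i" if "x < p" "y < p" "x \<noteq> y" for x y
      using i[of "{x, y}"] that by (auto simp: d nsets_2_eq)
    then have "pairwise (\<lambda>x y. c x y = i) ?S"
      by (auto simp: pairwise_def)
    moreover have "?S \<subseteq> V"
      using f hV by auto
    moreover have "card ?S = p"
      using comp_inj_on[OF f(1) inj_on_subset[OF bij_betw_imp_inj_on[OF h] f(2)]]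
      by (metis card_image card_lessThan)
    ultimately show False
      using mono[of ?S i] by (metis less_irrefl)
  qed
qed

section \<open>Lexicographic products\<close>

definition lex_colouring :: "('a \<Rightarrow> 'a \<Rightarrow> nat) \<Rightarrow> ('b \<Rightarrow> 'b \<Rightarrow> nat) \<Rightarrow> 'a \<times> 'b \<Rightarrow> 'a \<times> 'b \<Rightarrow> nat" where
  "lex_colouring c d u v = (if fst u \<noteq> fst v then c (fst u) (fst v) else d (snd u) (snd v))"

text \<open>
  A triangle meeting exactly two fibres has two edges between the same pair of fibres, hence of the
  same colour; every other triangle is a triangle of one of the factors.
\<close>

lemma no_rainbow_lex:
  assumes "no_rainbow A c" "no_rainbow B d" and sym: "\<And>x y. c x y = c y x"
  shows "no_rainbow (A \<times> B) (lex_colouring c d)"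
  unfolding no_rainbow_def
proof (intro ballI impI)
  fix u v w
  assume "u \<in> A \<times> B" "v \<in> A \<times> B" "w \<in> A \<times> B" "u \<noteq> v" "v \<noteq> w" "u \<noteq> w"
  then obtain x y x' y' x'' y'' where uvw: "u = (x, y)" "v = (x', y')" "w = (x'', y'')"
    and A: "x \<in> A" "x' \<in> A" "x'' \<in> A" and B: "y \<in> B" "y' \<in> B" "y'' \<in> B"
    and ne: "(x, y) \<noteq> (x', y')" "(x', y') \<noteq> (x'', y'')" "(x, y) \<noteq> (x'', y'')"
    by blast
  consider "x = x'" "x' = x''" | "x \<noteq> x'" "x' \<noteq> x''" "x \<noteq> x''"
    | "x = x'" "x' \<noteq> x''" | "x = x''" "x \<noteq> x'" | "x' = x''" "x \<noteq> x'"
    by blast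
  then show "lex_colouring c d u v = lex_colouring c d v w \<or> lex_colouring c d v w = lex_colouring c d u w \<or> lex_colouring c d u v = lex_colouring c d u w"
  proof cases
    case 1
    then show ?thesis
      using assms(2) B ne by (simp add: uvw lex_colouring_def no_rainbow_def)
  next
    case 2
    then show ?thesis
      using assms(1) A by (simp add: uvw lex_colouring_def no_rainbow_def)
  qed (auto simp: uvw lex_colouring_def sym)
qed

text \<open>
  A monochromatic set projects onto a monochromatic set of the first factor, and meets each fibre
  in a monochromatic set of the second one.
\<close>

lemma card_mono_lex:
  assumes "finite A" "finite B" and S: "S \<subseteq> A \<times> B" "pairwise (\<lambda>u v. lex_colouring c d u v = i) S"
    and c: "\<And>T. T \<subseteq> A \<Longrightarrow> pairwise (\<lambda>x y. c x y = i) T \<Longrightarrow> card T \<le> a"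
    and d: "\<And>T. T \<subseteq> B \<Longrightarrow> pairwise (\<lambda>x y. d x y = i) T \<Longrightarrow> card T \<le> b"
  shows "card S \<le> a * b"
proof -
  let ?F = "\<lambda>x. {y. (x, y) \<in> S}"
  have F: "?F x \<subseteq> B" for x
    using S by auto
  have "fst ` S \<subseteq> A"
    using S(1) by auto
  then have fin: "finite (fst ` S)" "\<And>x. finite (?F x)"
    using finite_subset[OF _ \<open>finite A\<close>] finite_subset[OF F \<open>finite B\<close>] by blast+
  have "pairwise (\<lambda>x y. c x y = i) (fst ` S)"
    using S(2) by (fastforce simp: pairwise_def lex_colouring_def)
  then have A: "card (fst ` S) \<le> a"
    using \<open>fst ` S \<subseteq> A\<close> by (intro c)
  have B: "card (?F x) \<le> b" for x
  proof (rule d[OF F])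
    show "pairwise (\<lambda>x y. d x y = i) (?F x)"
      using S(2) by (fastforce simp: pairwise_def lex_colouring_def)
  qed
  have "S = Sigma (fst ` S) ?F"
    by (auto intro: rev_image_eqI)
  then have "card S = card (Sigma (fst ` S) ?F)"
    by (rule arg_cong)
  also have "\<dots> = (\<Sum>x\<in>fst ` S. card (?F x))"
    using fin by (intro card_SigmaI) blast+
  also have "\<dots> \<le> card (fst ` S) * b"
    using sum_bounded_above[of "fst ` S" "\<lambda>x. card (?F x)" b] B by simp
  also have "\<dots> \<le> a * b"
    using A by simp
  finally show ?thesis .
qed

section \<open>The cubic-residue colouring on 13 vertices\<close>

text \<open>
  The differences \<open>\<plusminus>1, \<plusminus>5\<close> are the nonzero cubes modulo \<open>13\<close>; the pairs at these differences form
  the extremal graph for \<open>R(3,5) = 14\<close>.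
\<close>

definition cubic :: "int \<Rightarrow> int \<Rightarrow> bool" where
  "cubic x y \<longleftrightarrow> \<bar>x - y\<bar> \<in> {1, 5, 8, 12}"

lemma cubic_sym: "cubic x y = cubic y x"
  by (simp add: cubic_def abs_minus_commute)

definition cubic_colouring :: "nat \<Rightarrow> nat \<Rightarrow> int \<Rightarrow> int \<Rightarrow> nat" where
  "cubic_colouring i j x y = (if cubic x y then i else j)"

lemma sorted_list_of_card:
  fixes T :: "int set"
  assumes "n \<le> card T"
  obtains xs where "length xs = n" "sorted_wrt (<) xs" "set xs \<subseteq> T"
proof -
  obtain U where "U \<subseteq> T" "card U = n" "finite U"
    using obtain_subset_with_card_n[OF assms] by metis
  then show ?thesis
    using that[of "sorted_list_of_set U"] by simp
qed

text \<open>No two elements of \<open>{1, 5, 8, 12}\<close> have their sum in this set.\<close>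

lemma card_cubic_clique:
  assumes "pairwise cubic T"
  shows "card T \<le> 2"
proof (rule ccontr)
  assume "\<not> ?thesis"
  then obtain xs where xs: "length xs = 3" "sorted_wrt (<) xs" "set xs \<subseteq> T"
    using sorted_list_of_card[of 3 T] by auto
  then obtain a b c where "xs = [a, b, c]"
    by (auto simp: length_Suc_conv numeral_eq_Suc)
  then have "a < b" "b < c" "cubic a b" "cubic b c" "cubic a c"
    using xs assms by (auto simp: pairwise_def)
  then show False
    by (auto simp: cubic_def)
qed

text \<open>
  The five cyclic gaps of a 5-element set without cubic differences add up to \<open>13\<close> and none is \<open>1\<close>
  or \<open>5\<close>, so they are \<open>2,2,2,3,4\<close> or \<open>2,2,3,3,3\<close> in some order. In either case a gap \<open>2\<close> is next to
  a gap \<open>3\<close>, which makes a difference \<open>5\<close>. In the sorted representation the gap that passes through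
  \<open>0\<close> is \<open>13 - (e - a)\<close>, and this is where differences \<open>8\<close> and \<open>12\<close> matter.
\<close>

lemma card_cubic_independent:
  assumes T: "T \<subseteq> {0..<13}" and indep: "pairwise (\<lambda>x y. \<not> cubic x y) T"
  shows "card T \<le> 4"
proof (rule ccontr)
  assume "\<not> ?thesis"
  then obtain xs where xs: "length xs = 5" "sorted_wrt (<) xs" "set xs \<subseteq> T"
    using sorted_list_of_card[of 5 T] by auto
  then obtain a b c d e where "xs = [a, b, c, d, e]"
    by (auto simp: length_Suc_conv numeral_eq_Suc)
  then have lt: "a < b" "b < c" "c < d" "d < e" and T': "a \<in> T" "b \<in> T" "c \<in> T" "d \<in> T" "e \<in> T"
    using xs by auto
  have bounds: "e - a \<le> 12"
    using subsetD[OF T T'(1)] subsetD[OF T T'(5)] by simp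
  have far: "y - x \<ge> 2 \<and> y - x \<noteq> 5 \<and> y - x \<noteq> 8 \<and> y - x \<noteq> 12"
    if "x \<in> T" "y \<in> T" "x < y" for x y
    using pairwiseD[OF indep, of x y] that by (auto simp: cubic_def)
  define p q r s where gaps: "p = b - a" "q = c - b" "r = d - c" "s = e - d"
  have ge: "p \<ge> 2" "q \<ge> 2" "r \<ge> 2" "s \<ge> 2"
    using far[of a b] far[of b c] far[of c d] far[of d e] T' lt by (auto simp: gaps)
  have total: "p + q + r + s \<le> 11"
    using far[of a e] T' lt bounds by (auto simp: gaps)
  have not5: "p \<noteq> 5" "q \<noteq> 5" "r \<noteq> 5" "s \<noteq> 5"
    using far[of a b] far[of b c] far[of c d] far[of d e] T' lt by (auto simp: gaps)
  have lt': "a < c" "b < d" "c < e" "a < d" "b < e" "a < e"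
    using lt by linarith+
  have sums2: "p + q \<noteq> 5" "q + r \<noteq> 5" "r + s \<noteq> 5"
    using far[OF T'(1,3) lt'(1)] far[OF T'(2,4) lt'(2)] far[OF T'(3,5) lt'(3)]
    by (simp_all add: gaps)
  have sums3: "p + q + r \<noteq> 8" "q + r + s \<noteq> 8"
    using far[OF T'(1,4) lt'(4)] far[OF T'(2,5) lt'(5)] by (simp_all add: gaps)
  have sum4: "p + q + r + s \<noteq> 8"
    using far[OF T'(1,5) lt'(6)] by (simp add: gaps)
  have "p = 2 \<or> p = 3 \<or> p = 4" using ge total not5(1) by linarith
  moreover have "q = 2 \<or> q = 3 \<or> q = 4" using ge total not5(2) by linarith
  moreover have "r = 2 \<or> r = 3 \<or> r = 4" using ge total not5(3) by linarith
  moreover have "s = 2 \<or> s = 3 \<or> s = 4" using ge total not5(4) by linarith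
  ultimately show False
    using sums2 sums3 sum4 total by (elim disjE) simp_all
qed

lemma card_mono_cubic_colouring:
  assumes "T \<subseteq> {0..<13}" "pairwise (\<lambda>x y. cubic_colouring i j x y = l) T" "i \<noteq> j"
  shows "card T \<le> (if l = i then 2 else if l = j then 4 else 1)"
proof -
  consider "l = i" | "l = j" "l \<noteq> i" | "l \<noteq> i" "l \<noteq> j"
    by blast
  then show ?thesis
  proof cases
    case 1
    then have "pairwise cubic T"
      using assms(2,3) by (auto simp: pairwise_def cubic_colouring_def split: if_splits)
    then show ?thesis
      using 1 card_cubic_clique by simp
  next
    case 2
    then have "pairwise (\<lambda>x y. \<not> cubic x y) T"
      using assms(2,3) by (auto simp: pairwise_def cubic_colouring_def split: if_splits)
    then show ?thesis
      using 2 card_cubic_independent[OF assms(1)] by simp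
  next
    case 3
    then have "x = y" if "x \<in> T" "y \<in> T" for x y
      using assms(2) that by (auto simp: pairwise_def cubic_colouring_def split: if_splits)
    then have "card T \<le> Suc 0"
      using finite_subset[OF assms(1)] by (auto simp: card_le_Suc0_iff_eq)
    then show ?thesis
      using 3 by simp
  qed
qed

section \<open>Three colours and \<open>K\<^sub>5\<close>\<close>

lemma gallai_ramsey_3_5: "169 < gallai_ramsey 3 (complete_graph 5)"
proof -
  let ?Z = "{0..<13::int}"
  let ?c = "cubic_colouring 0 1" and ?d = "cubic_colouring 0 2"
  have rainbow: "no_rainbow ?Z (cubic_colouring i j)" for i j
    by (auto simp: no_rainbow_def cubic_colouring_def)
  have "card (?Z \<times> ?Z) < gallai_ramsey 3 (complete_graph 5)"
  proof (rule gallai_ramsey_greater[where c = "lex_colouring ?c ?d"])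
    show "no_rainbow (?Z \<times> ?Z) (lex_colouring ?c ?d)"
      by (intro no_rainbow_lex rainbow) (simp add: cubic_colouring_def cubic_sym)
  next
    fix i S
    assume S: "S \<subseteq> ?Z \<times> ?Z" "pairwise (\<lambda>u v. lex_colouring ?c ?d u v = i) S"
    have "card S \<le> (if i = 0 then 2 else if i = 1 then 4 else 1) *
        (if i = 0 then 2 else if i = 2 then 4 else 1)"
      by (rule card_mono_lex[OF _ _ S]) (use card_mono_cubic_colouring in auto)
    also have "\<dots> < 5"
      by simp
    finally show "card S < 5" .
  qed (auto simp: lex_colouring_def cubic_colouring_def cubic_sym)
  then show ?thesis
    by simp
qed

theorem mainTheorem3:
  shows "\<not> (\<forall>k p :: nat. k \<ge> 1 \<longrightarrow> p \<ge> 3 \<longrightarrow>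
              gallai_ramsey k (complete_graph p) =
                (if even k then (ramsey_number p - 1) ^ (k div 2) + 1
                 else (p - 1) * (ramsey_number p - 1) ^ ((k - 1) div 2) + 1))
         \<or> \<not> ramsey_number 5 = 43"
proof (rule ccontr, unfold de_Morgan_disj not_not, elim conjE)
  assume formula: "\<forall>k p :: nat. k \<ge> 1 \<longrightarrow> p \<ge> 3 \<longrightarrow>
              gallai_ramsey k (complete_graph p) =
                (if even k then (ramsey_number p - 1) ^ (k div 2) + 1
                 else (p - 1) * (ramsey_number p - 1) ^ ((k - 1) div 2) + 1)"
    and "ramsey_number 5 = 43"
  then have "gallai_ramsey 3 (complete_graph 5) = 169"
    using formula[rule_format, of 3 5] by simp
  then show False
    using gallai_ramsey_3_5 by simp
qed

end
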